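(* Let $\sigma>0$, let $y\in\mathbb{R}^{m+1}$ satisfy $Q-\mathcal{A}^\top y\succ0$ and $y_{kl}\le0$ for all index pairs $kl$, and let $W=(Q-\mathcal{A}^\top y)^{-1}$. Let $ij$ ($1\le i\le n$, $l_i\le j\le u_i$) be a coordinate, and write \[ \nabla_s f(y+se_{ij};\sigma)=\beta_{ij}-\sigma\langle A_{ij},(W^{-1}-sA_{ij})^{-1}\rangle ,\qquad \nabla_y f(y;\sigma)_{ij}=\beta_{ij}-\sigma\langle A_{ij},W\rangle . \] (i) Suppose $\nabla_y f(y;\sigma)_{ij}>0$ and $y_{ij}<0$. If the function $s\mapsto\nabla_s f(y+se_{ij};\sigma)$ has at least one positive root, then for the smallest positive root $s^+$, either $y+s^+e_{ij}$ is dual feasible and $\nabla_s f(y+s^+e_{ij};\sigma)=0$, or $y_{ij}+s^+>0$ and $\nabla_s f(y-y_{ij}e_{ij};\sigma)>0$. Otherwise (if there is no positive root) $\nabla_s f(y-y_{ij}e_{ij};\sigma)>0$. (ii) Suppose $\nabla_y f(y;\sigma)_{ij}<0$. Then the function $s\mapsto\nabla_s f(y+se_{ij};\sigma)$ has at least one negative root, and for the biggest negative root $s^-$, the point $y+s^-e_{ij}$ is dual feasible and $\nabla_s f(y+s^-e_{ij};\sigma)=0$.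
   Context: Let $n\ge 1$, let $\hat Q\in\mathbb{R}^{n\times n}$ be symmetric (not necessarily positive semidefinite), $\hat l\in\mathbb{R}^n$, $\hat c\in\mathbb{R}$. For $i=1,\dots,n$ let $l_i,u_i\in\mathbb{Z}$ with $l_i<u_i$, $n_i=u_i-l_i+1$, and $m=\sum_{i=1}^n n_i$. Let $\beta=(\beta_{ij})_{1\le i\le n,\ l_i\le j\le u_i}\in\mathbb{R}^m$ be arbitrary. $S_{n+1}$ denotes the real symmetric $(n+1)\times(n+1)$ matrices, with rows and columns indexed by $0,1,\dots,n$, and $\langle\cdot,\cdot\rangle$ is the trace (Frobenius) inner product on matrices and the standard inner product on vectors. Put $Q=\begin{pmatrix}\hat c & \frac12\hat l^\top\\ \frac12\hat l & \hat Q\end{pmatrix}\in S_{n+1}$ and $A_0=e_0e_0^\top$, where $e_0=(1,0,\dots,0)^\top\in\mathbb{R}^{n+1}$. For $1\le i\le n$ and $l_i\le j\le u_i$ let $A_{ij}\in S_{n+1}$ be the matrix whose only possibly nonzero entries are: for $j=u_i$: $(A_{iu_i})_{00}=\beta_{iu_i}+l_iu_i$, $(A_{iu_i})_{0i}=(A_{iu_i})_{i0}=-\frac12(l_i+u_i)$, $(A_{iu_i})_{ii}=1$; for $l_i\le j\le u_i-1$: $(A_{ij})_{00}=\beta_{ij}-j(j+1)$, $(A_{ij})_{0i}=(A_{ij})_{i0}=j+\frac12$, $(A_{ij})_{ii}=-1$. Vectors $y\in\mathbb{R}^{m+1}$ have coordinates $y_0$ and $y_{ij}$ ($1\le i\le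 n$, $l_i\le j\le u_i$); $e_{ij}\in\mathbb{R}^{m+1}$ denotes the corresponding unit vector. Put $\mathcal{A}^\top y=y_0A_0+\sum_{i,j}y_{ij}A_{ij}$, and let $b\in\mathbb{R}^{m+1}$ be given by $b_0=1$, $b_{ij}=\beta_{ij}$. A vector $y$ is dual feasible if $Q-\mathcal{A}^\top y\succeq0$ and $y_{ij}\le0$ for all $i,j$ ($y_0$ is free). The barrier function is $f(y;\sigma)=\langle b,y\rangle+\sigma\log\det(Q-\mathcal{A}^\top y)$ on $\{y: Q-\mathcal{A}^\top y\succ0\}$. The expression $\nabla_s f(y+se_{ij};\sigma)$, which is the derivative of $s\mapsto f(y+se_{ij};\sigma)$ where $Q-\mathcal{A}^\top(y+se_{ij})\succ0$, is regarded as a (rational) function of $s$ defined for all $s$ for which $W^{-1}-sA_{ij}$ is invertible; a root is such an $s$ at which it vanishes. $\nabla_s f(y-y_{ij}e_{ij};\sigma)$ denotes its value at $s=-y_{ij}$. *)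

theory Defs
  imports "HOL-Analysis.Analysis"
begin

text \<open>
  The coordinates \<open>1..n\<close> are the elements of a finite type \<open>'n\<close>; the coordinates \<open>0..n\<close> are the
  elements of \<open>'n option\<close>, where \<open>None\<close> plays the role of \<open>0\<close>. On matrices, the library's \<open>\<bullet>\<close> is
  the Frobenius inner product.
\<close>

definition pos_semidef :: "real^'k::finite^'k \<Rightarrow> bool" where
  "pos_semidef M \<longleftrightarrow> transpose M = M \<and> (\<forall>x. x \<bullet> (M *v x) \<ge> 0)"

definition pos_def :: "real^'k::finite^'k \<Rightarrow> bool" where
  "pos_def M \<longleftrightarrow> transpose M = M \<and> (\<forall>x. x \<noteq> 0 \<longrightarrow> x \<bullet> (M *v x) > 0)"

definition Q_mat :: "real^'n::finite^'n \<Rightarrow> real^'n \<Rightarrow> real \<Rightarrow> real^('n option)^('n option)" where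
  "Q_mat Qh lh ch = (\<chi> p q.
     (case (p, q) of
        (None, None) \<Rightarrow> ch
      | (None, Some j) \<Rightarrow> lh $ j / 2
      | (Some i, None) \<Rightarrow> lh $ i / 2
      | (Some i, Some j) \<Rightarrow> Qh $ i $ j))"

definition A0_mat :: "real^('n::finite option)^('n option)" where
  "A0_mat = (\<chi> p q. if p = None \<and> q = None then 1 else 0)"

definition arrow_mat :: "'n::finite \<Rightarrow> real \<Rightarrow> real \<Rightarrow> real \<Rightarrow> real^('n option)^('n option)" where
  "arrow_mat i a b c = (\<chi> p q.
     if p = None \<and> q = None then a
     else if (p = None \<and> q = Some i) \<or> (p = Some i \<and> q = None) then b
     else if p = Some i \<and> q = Some i then c
     else 0)"

definition A_mat ::
  "('n::finite \<Rightarrow> int) \<Rightarrow> ('n \<Rightarrow> int) \<Rightarrow> ('n \<Rightarrow> int \<Rightarrow> real) \<Rightarrow> 'n \<Rightarrow> int \<Rightarrow> real^('n option)^('n option)"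
where
  "A_mat l u \<beta> i j =
     (if j = u i
      then arrow_mat i (\<beta> i j + of_int (l i * u i)) (- (of_int (l i + u i) / 2)) 1
      else arrow_mat i (\<beta> i j - of_int (j * (j + 1))) (of_int j + 1 / 2) (- 1))"

definition pairs :: "('n::finite \<Rightarrow> int) \<Rightarrow> ('n \<Rightarrow> int) \<Rightarrow> ('n \<times> int) set" where
  "pairs l u = (SIGMA i:UNIV. {l i..u i})"

text \<open>
  A vector of \<open>\<real>\<^bsup>m+1\<^esup>\<close> is a function on \<open>('n \<times> int) option\<close>: \<open>y None\<close> is \<open>y\<^sub>0\<close>, and \<open>y (Some (i, j))\<close>
  is \<open>y\<^sub>i\<^sub>j\<close>. Only its values at \<open>None\<close> and at the pairs in \<open>pairs l u\<close> are ever used.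
\<close>

type_synonym 'n dvec = "('n \<times> int) option \<Rightarrow> real"

definition shift :: "'n dvec \<Rightarrow> real \<Rightarrow> 'n \<Rightarrow> int \<Rightarrow> 'n dvec" where \<comment> \<open>\<open>y + s e\<^sub>i\<^sub>j\<close>\<close>
  "shift y s i j = (\<lambda>p. y p + s * (if p = Some (i, j) then 1 else 0))"

definition adjoint_map ::
  "('n::finite \<Rightarrow> int) \<Rightarrow> ('n \<Rightarrow> int) \<Rightarrow> ('n \<Rightarrow> int \<Rightarrow> real) \<Rightarrow> 'n dvec \<Rightarrow> real^('n option)^('n option)"
where
  "adjoint_map l u \<beta> y =
     y None *\<^sub>R A0_mat + (\<Sum>(i, j)\<in>pairs l u. y (Some (i, j)) *\<^sub>R A_mat l u \<beta> i j)"

definition b_vec :: "('n \<Rightarrow> int \<Rightarrow> real) \<Rightarrow> 'n dvec" where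
  "b_vec \<beta> p = (case p of None \<Rightarrow> 1 | Some (i, j) \<Rightarrow> \<beta> i j)"

definition dvec_inner :: "('n::finite \<Rightarrow> int) \<Rightarrow> ('n \<Rightarrow> int) \<Rightarrow> 'n dvec \<Rightarrow> 'n dvec \<Rightarrow> real" where
  "dvec_inner l u v w = (\<Sum>p\<in>insert None (Some ` pairs l u). v p * w p)"

definition slack ::
  "real^('n::finite option)^('n option) \<Rightarrow> ('n \<Rightarrow> int) \<Rightarrow> ('n \<Rightarrow> int) \<Rightarrow> ('n \<Rightarrow> int \<Rightarrow> real)
    \<Rightarrow> 'n dvec \<Rightarrow> real^('n option)^('n option)"
where
  "slack Q l u \<beta> y = Q - adjoint_map l u \<beta> y"

definition dual_feasible ::
  "real^('n::finite option)^('n option) \<Rightarrow> ('n \<Rightarrow> int) \<Rightarrow> ('n \<Rightarrow> int) \<Rightarrow> ('n \<Rightarrow> int \<Rightarrow> real)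
    \<Rightarrow> 'n dvec \<Rightarrow> bool"
where
  "dual_feasible Q l u \<beta> y \<longleftrightarrow>
     pos_semidef (slack Q l u \<beta> y) \<and> (\<forall>(k, h)\<in>pairs l u. y (Some (k, h)) \<le> 0)"

text \<open>Meaningful only where \<open>slack Q l u \<beta> y\<close> is positive definite.\<close>

definition barrier ::
  "real^('n::finite option)^('n option) \<Rightarrow> ('n \<Rightarrow> int) \<Rightarrow> ('n \<Rightarrow> int) \<Rightarrow> ('n \<Rightarrow> int \<Rightarrow> real)
    \<Rightarrow> real \<Rightarrow> 'n dvec \<Rightarrow> real"
where
  "barrier Q l u \<beta> \<sigma> y = dvec_inner l u (b_vec \<beta>) y + \<sigma> * ln (det (slack Q l u \<beta> y))"

text \<open>
  The next three notions refer to the rational function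
  \<open>s \<mapsto> \<beta>\<^sub>i\<^sub>j - \<sigma> \<langle>A\<^sub>i\<^sub>j, (W\<^sup>-\<^sup>1 - s A\<^sub>i\<^sub>j)\<^sup>-\<^sup>1\<rangle>\<close>, whose domain is given by \<open>line_dom\<close>. Since \<open>matrix_inv\<close>
  returns an unspecified matrix at a non-invertible argument, \<open>line_grad\<close> has to be used together
  with \<open>line_dom\<close>.
\<close>

definition line_dom ::
  "('n::finite \<Rightarrow> int) \<Rightarrow> ('n \<Rightarrow> int) \<Rightarrow> ('n \<Rightarrow> int \<Rightarrow> real) \<Rightarrow> real^('n option)^('n option)
    \<Rightarrow> 'n \<Rightarrow> int \<Rightarrow> real set"
where
  "line_dom l u \<beta> W i j = {s. invertible (matrix_inv W - s *\<^sub>R A_mat l u \<beta> i j)}"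

definition line_grad ::
  "('n::finite \<Rightarrow> int) \<Rightarrow> ('n \<Rightarrow> int) \<Rightarrow> ('n \<Rightarrow> int \<Rightarrow> real) \<Rightarrow> real \<Rightarrow> real^('n option)^('n option)
    \<Rightarrow> 'n \<Rightarrow> int \<Rightarrow> real \<Rightarrow> real"
where
  "line_grad l u \<beta> \<sigma> W i j s =
     \<beta> i j - \<sigma> * (A_mat l u \<beta> i j \<bullet> matrix_inv (matrix_inv W - s *\<^sub>R A_mat l u \<beta> i j))"

definition line_root ::
  "('n::finite \<Rightarrow> int) \<Rightarrow> ('n \<Rightarrow> int) \<Rightarrow> ('n \<Rightarrow> int \<Rightarrow> real) \<Rightarrow> real \<Rightarrow> real^('n option)^('n option)
    \<Rightarrow> 'n \<Rightarrow> int \<Rightarrow> real \<Rightarrow> bool"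
where
  "line_root l u \<beta> \<sigma> W i j s \<longleftrightarrow> s \<in> line_dom l u \<beta> W i j \<and> line_grad l u \<beta> \<sigma> W i j s = 0"

definition coord_grad ::
  "('n::finite \<Rightarrow> int) \<Rightarrow> ('n \<Rightarrow> int) \<Rightarrow> ('n \<Rightarrow> int \<Rightarrow> real) \<Rightarrow> real \<Rightarrow> real^('n option)^('n option)
    \<Rightarrow> 'n \<Rightarrow> int \<Rightarrow> real"
where
  "coord_grad l u \<beta> \<sigma> W i j = \<beta> i j - \<sigma> * (A_mat l u \<beta> i j \<bullet> W)"

end

theory Submission
  imports Defs "HOL-Real_Asymp.Real_Asymp"
begin

text \<open>
  Fix the coordinate \<open>ij\<close>, put \<open>S = W\<^sup>-\<^sup>1\<close> and \<open>A = A\<^sub>i\<^sub>j\<close>, and restrict the barrier to the line: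
  up to a constant it is \<open>\<phi>(s) = \<beta>\<^sub>i\<^sub>j s + \<sigma> log det (S - s A)\<close>, with derivative
  \<open>\<phi>'(s) = \<beta>\<^sub>i\<^sub>j - \<sigma> \<langle>A, (S - s A)\<^sup>-\<^sup>1\<rangle>\<close> by Jacobi's formula.

  Leave \<open>s = 0\<close> in the direction in which \<open>\<phi>\<close> increases. While its
  directional derivative stays positive, \<open>\<phi>\<close> exceeds its initial value, so on bounded stretches
  the determinant stays away from \<open>0\<close>; the matrix therefore cannot become singular before the
  derivative vanishes. Hence there are two cases (\<open>log_det_ray_dichotomy\<close>): either the whole ray
  is positive definite with positive directional derivative, or there is a first root, with
  positive definiteness up to and including it and positive derivative before it.

  For (i), going right, the first case gives the claim without a root. In the second case the
  first root \<open>s\<^sup>+\<close> is dual feasible if \<open>y\<^sub>i\<^sub>j + s\<^sup>+ \<le> 0\<close>; otherwise \<open>-y\<^sub>i\<^sub>j\<close> lies before it.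

  For (ii), going left, the first case is impossible. It would make \<open>A\<close> positive semidefinite,
  and the particular shape of \<open>A\<close> together with \<open>l\<^sub>i < u\<^sub>i\<close> then gives \<open>\<beta>\<^sub>i\<^sub>j > 0\<close>
  (\<open>A_mat_nonneg_imp_beta_pos\<close>). So \<open>\<beta>\<^sub>i\<^sub>j s\<close> tends to \<open>-\<infinity>\<close> linearly, which the logarithm of a
  polynomially bounded determinant cannot compensate for (\<open>log_det_ray_not_increasing\<close>), whereas
  \<open>\<phi>\<close> was supposed to increase. In the second case, moving left keeps \<open>y\<^sub>i\<^sub>j\<close> nonpositive, so
  the root is dual feasible.
\<close>

section \<open>Determinants along a line of matrices\<close>

lemma continuous_on_det:
  fixes F :: "'a::topological_space \<Rightarrow> real^'k::finite^'k"
  assumes "\<And>p q. continuous_on S (\<lambda>t. F t $ p $ q)"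
  shows "continuous_on S (\<lambda>t. det (F t))"
  unfolding det_def by (intro continuous_intros assms)

definition row_replace :: "real^'k^'k \<Rightarrow> real^'k^'k \<Rightarrow> 'k \<Rightarrow> real^'k::finite^'k" where
  "row_replace M B k = (\<chi> p. if p = k then B $ p else M $ p)"

text \<open>
  The product rule in every term of the Leibniz expansion. This form of the derivative is a
  polynomial in \<open>t\<close>, hence continuous also where the matrix is singular.
\<close>

lemma det_line_has_derivative_rows:
  fixes M B :: "real^'k::finite^'k"
  shows "((\<lambda>t. det (M + t *\<^sub>R B)) has_real_derivative
           (\<Sum>k\<in>UNIV. det (row_replace (M + t *\<^sub>R B) B k))) (at t)"
proof -
  have row: "det (row_replace (M + t *\<^sub>R B) B k) =
      (\<Sum>\<pi> | \<pi> permutes UNIV. of_int (sign \<pi>) *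
         (B $ k $ \<pi> k * (\<Prod>p\<in>UNIV - {k}. M $ p $ \<pi> p + t * B $ p $ \<pi> p)))" for k
    unfolding det_def row_replace_def
    by (intro sum.cong refl) (simp add: prod.remove[of UNIV k])
  have "((\<lambda>t. det (M + t *\<^sub>R B)) has_real_derivative
          (\<Sum>\<pi> | \<pi> permutes UNIV. of_int (sign \<pi>) * (\<Sum>k\<in>UNIV.
             B $ k $ \<pi> k * (\<Prod>p\<in>UNIV - {k}. M $ p $ \<pi> p + t * B $ p $ \<pi> p)))) (at t)"
    unfolding det_def
    by (auto intro!: derivative_eq_intros has_field_derivative_prod sum.cong)
  also have "(\<Sum>\<pi> | \<pi> permutes UNIV. of_int (sign \<pi>) * (\<Sum>k\<in>UNIV.
             B $ k $ \<pi> k * (\<Prod>p\<in>UNIV - {k}. M $ p $ \<pi> p + t * B $ p $ \<pi> p)))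
      = (\<Sum>k\<in>UNIV. det (row_replace (M + t *\<^sub>R B) B k))"
    unfolding row sum_distrib_left by (rule sum.swap)
  finally show ?thesis .
qed

lemma matrix_inv_mult:
  fixes M :: "real^'k::finite^'k"
  assumes "invertible M"
  shows "M ** matrix_inv M = mat 1" "matrix_inv M ** M = mat 1"
  using someI_ex[OF assms[unfolded invertible_def]] unfolding matrix_inv_def by blast+

lemma matrix_inv_unique:
  fixes M X :: "real^'k::finite^'k"
  assumes "M ** X = mat 1"
  shows "matrix_inv M = X"
proof -
  have "invertible M" using assms invertible_right_inverse by blast
  then have "matrix_inv M ** (M ** X) = X"
    by (simp add: matrix_inv_mult matrix_mul_assoc)
  with assms show ?thesis by simp
qed

lemma matrix_inv_matrix_inv:
  fixes M :: "real^'k::finite^'k"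
  assumes "invertible M"
  shows "matrix_inv (matrix_inv M) = M"
  using assms by (simp add: matrix_inv_mult matrix_inv_unique)

lemma transpose_matrix_inv_symmetric:
  fixes M :: "real^'k::finite^'k"
  assumes "invertible M" "transpose M = M"
  shows "transpose (matrix_inv M) = matrix_inv M"
proof -
  have "M ** transpose (matrix_inv M) = mat 1"
    using matrix_inv_mult(2)[OF assms(1)] assms(2) by (metis matrix_transpose_mul transpose_mat)
  then show ?thesis using matrix_inv_unique by metis
qed

lemma symmetric_matrix_entry:
  fixes M :: "'a^'k^'k"
  assumes "transpose M = M"
  shows "M $ p $ q = M $ q $ p"
proof -
  have "transpose M $ p $ q = M $ q $ p" by (simp add: transpose_def)
  with assms show ?thesis by simp
qed

text \<open>
  Writing the rows of \<open>B\<close> as combinations of the rows of the invertible matrix \<open>M\<close>, with the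
  coefficients \<open>B M\<^sup>-\<^sup>1\<close>, Cramer's rule leaves only the diagonal coefficient.
\<close>

lemma sum_det_row_replace:
  fixes M B :: "real^'k::finite^'k"
  assumes inv: "invertible M" and sym: "transpose M = M"
  shows "(\<Sum>k\<in>UNIV. det (row_replace M B k)) = (B \<bullet> matrix_inv M) * det M"
proof -
  define C where "C = B ** matrix_inv M"
  have B: "B = C ** M"
    by (simp add: C_def matrix_inv_mult[OF inv] flip: matrix_mul_assoc)
  have "det (row_replace M B k) = C $ k $ k * det M" for k
  proof -
    have "row_replace M B k = (\<chi> p. if p = k then (\<Sum>q\<in>UNIV. C $ k $ q *s row q M) else row p M)"
      unfolding row_replace_def by (subst B)
        (simp add: vec_eq_iff matrix_matrix_mult_def row_def vector_scalar_mult_def)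
    then show ?thesis
      using cramer_lemma_transpose[of k "C $ k" M] by simp
  qed
  then have "(\<Sum>k\<in>UNIV. det (row_replace M B k)) = (\<Sum>k\<in>UNIV. C $ k $ k) * det M"
    by (simp add: sum_distrib_right)
  also have "C $ k $ k = B $ k \<bullet> matrix_inv M $ k" for k
  proof -
    have "matrix_inv M $ q $ k = matrix_inv M $ k $ q" for q
      by (intro symmetric_matrix_entry transpose_matrix_inv_symmetric inv sym)
    then show ?thesis
      by (simp add: C_def matrix_matrix_mult_def inner_vec_def)
  qed
  then have "(\<Sum>k\<in>UNIV. C $ k $ k) = B \<bullet> matrix_inv M"
    by (simp add: inner_vec_def)
  finally show ?thesis .
qed

lemma transpose_add_scaleR_symmetric:
  fixes M B :: "real^'k::finite^'k"
  assumes "transpose M = M" "transpose B = B"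
  shows "transpose (M + t *\<^sub>R B) = M + t *\<^sub>R B"
  using assms[THEN symmetric_matrix_entry] by (simp add: transpose_def vec_eq_iff)

text \<open>
  Bounding each entry of \<open>M + t B\<close> by a multiple of \<open>1 + t\<close> shows that the determinant grows at
  most polynomially; this is what a linearly growing logarithm would violate.
\<close>

lemma det_line_polynomial_bound:
  fixes M B :: "real^'k::finite^'k"
  obtains K where "K > 0" "\<And>t. t \<ge> 0 \<Longrightarrow> det (M + t *\<^sub>R B) \<le> K * (1 + t) ^ CARD('k)"
proof
  define c where "c = norm M + norm B + 1"
  define K where "K = real (card {\<pi>. \<pi> permutes (UNIV :: 'k set)}) * c ^ CARD('k)"
  have c: "c > 0" unfolding c_def by (simp add: add_nonneg_pos)
  have "card {\<pi>. \<pi> permutes (UNIV :: 'k set)} = fact CARD('k)"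
    by (rule card_permutations) auto
  then show "K > 0" unfolding K_def using c by simp
  fix t :: real assume t: "t \<ge> 0"
  have entry: "\<bar>(M + t *\<^sub>R B) $ p $ q\<bar> \<le> c * (1 + t)" for p q
  proof -
    have le: "\<bar>X $ p $ q\<bar> \<le> norm X" for X :: "real^'k^'k"
      by (metis Finite_Cartesian_Product.norm_nth_le order_trans real_norm_def)
    have "\<bar>(M + t *\<^sub>R B) $ p $ q\<bar> \<le> \<bar>M $ p $ q\<bar> + t * \<bar>B $ p $ q\<bar>"
      using abs_triangle_ineq[of "M $ p $ q" "t * B $ p $ q"] t by (simp add: abs_mult)
    also have "\<dots> \<le> norm M + t * norm B"
      by (intro add_mono mult_left_mono le t)
    also have "\<dots> \<le> c * (1 + t)"
      unfolding c_def using t by (simp add: algebra_simps)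
    finally show ?thesis .
  qed
  have "det (M + t *\<^sub>R B) \<le> (\<Sum>\<pi> | \<pi> permutes (UNIV :: 'k set). (c * (1 + t)) ^ CARD('k))"
    unfolding det_def
  proof (rule sum_mono)
    fix \<pi> :: "'k \<Rightarrow> 'k"
    have "of_int (sign \<pi>) * (\<Prod>p\<in>UNIV. (M + t *\<^sub>R B) $ p $ \<pi> p)
        \<le> \<bar>\<Prod>p\<in>UNIV. (M + t *\<^sub>R B) $ p $ \<pi> p\<bar>"
      by (auto simp: sign_def)
    also have "\<dots> \<le> (\<Prod>p\<in>(UNIV::'k set). c * (1 + t))"
      unfolding abs_prod by (intro prod_mono) (use entry in auto)
    finally show "of_int (sign \<pi>) * (\<Prod>p\<in>UNIV. (M + t *\<^sub>R B) $ p $ \<pi> p)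
        \<le> (c * (1 + t)) ^ CARD('k)" by simp
  qed
  also have "\<dots> = K * (1 + t) ^ CARD('k)"
    unfolding K_def by (simp add: power_mult_distrib)
  finally show "det (M + t *\<^sub>R B) \<le> K * (1 + t) ^ CARD('k)" .
qed

section \<open>Positive definite matrices\<close>

lemma quadratic_form_line:
  fixes M B :: "real^'k::finite^'k"
  shows "x \<bullet> ((M + t *\<^sub>R B) *v x) = x \<bullet> (M *v x) + t * (x \<bullet> (B *v x))"
  by (simp add: matrix_vector_mult_add_rdistrib inner_add_right flip: scaleR_matrix_vector_assoc)

lemma pos_def_imp_pos_semidef:
  assumes "pos_def M"
  shows "pos_semidef M"
  unfolding pos_semidef_def
proof (intro conjI allI)
  show "transpose M = M" using assms by (simp add: pos_def_def)
  show "0 \<le> x \<bullet> (M *v x)" for x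
    using assms by (cases "x = 0") (auto simp: pos_def_def intro: less_imp_le)
qed

lemma pos_def_imp_invertible:
  fixes M :: "real^'k::finite^'k"
  assumes "pos_def M"
  shows "invertible M"
proof -
  have "x = 0" if "M *v x = 0" for x
    using assms that unfolding pos_def_def by (metis inner_zero_right less_irrefl)
  then show ?thesis
    unfolding invertible_left_inverse matrix_left_invertible_ker by blast
qed

text \<open>
  The segment from the identity to a positive definite matrix stays positive definite, hence
  invertible, so the determinant keeps the sign that it has at the identity.
\<close>

lemma pos_def_imp_det_pos:
  fixes M :: "real^'k::finite^'k"
  assumes M: "pos_def M"
  shows "det M > 0"
proof (rule ccontr)
  let ?F = "\<lambda>t::real. (1 - t) *\<^sub>R mat 1 + t *\<^sub>R M"
  assume "\<not> det M > 0"
  moreover have "continuous_on {0..1} (\<lambda>t. det (?F t))"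
    by (intro continuous_on_det) (auto intro!: continuous_intros)
  ultimately obtain t where t: "0 \<le> t" "t \<le> 1" "det (?F t) = 0"
    using IVT2'[of "\<lambda>t. det (?F t)" 1 0 0] by auto
  have "pos_def (?F t)"
  proof -
    have "M $ p $ q = M $ q $ p" for p q
      using M by (intro symmetric_matrix_entry) (simp add: pos_def_def)
    then have sym: "transpose (?F t) = ?F t"
      by (auto simp: transpose_def vec_eq_iff mat_def)
    have "x \<bullet> (?F t *v x) > 0" if x: "x \<noteq> 0" for x
    proof -
      have eq: "x \<bullet> (?F t *v x) = (1 - t) * (x \<bullet> x) + t * (x \<bullet> (M *v x))"
        by (simp add: matrix_vector_mult_add_rdistrib inner_add_right
            flip: scaleR_matrix_vector_assoc)
      have "x \<bullet> x > 0" "x \<bullet> (M *v x) > 0"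
        using x M by (auto simp: pos_def_def)
      then show ?thesis
        unfolding eq using t
        by (cases "t = 0") (auto intro: add_nonneg_pos)
    qed
    with sym show ?thesis by (simp add: pos_def_def)
  qed
  with t show False
    using pos_def_imp_invertible invertible_det_nz by blast
qed

text \<open>
  A vector on which a semidefinite form vanishes minimises the form, so the gradient \<open>2 M x\<close>
  vanishes there and \<open>x\<close> lies in the kernel.
\<close>

lemma pos_semidef_invertible_imp_pos_def:
  fixes M :: "real^'k::finite^'k"
  assumes psd: "pos_semidef M" and inv: "invertible M"
  shows "pos_def M"
  unfolding pos_def_def
proof (intro conjI allI impI)
  show sym: "transpose M = M" using psd by (simp add: pos_semidef_def)
  fix x :: "real^'k" assume x: "x \<noteq> 0"
  show "x \<bullet> (M *v x) > 0"
  proof (rule ccontr)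
    assume "\<not> x \<bullet> (M *v x) > 0"
    then have x0: "x \<bullet> (M *v x) = 0"
      using psd unfolding pos_semidef_def by (metis linorder_not_less order_antisym)
    define v where "v = M *v x"
    have vx: "x \<bullet> (M *v v) = v \<bullet> v"
      by (metis v_def dot_lmul_matrix inner_commute sym transpose_matrix_vector)
    have form: "(x + e *\<^sub>R v) \<bullet> (M *v (x + e *\<^sub>R v))
        = 2 * e * (v \<bullet> v) + e\<^sup>2 * (v \<bullet> (M *v v))" for e
      using x0 vx unfolding v_def[symmetric]
      by (simp add: matrix_vector_right_distrib matrix_vector_mult_scaleR inner_add_left
          inner_add_right power2_eq_square algebra_simps flip: v_def)
    have ge: "2 * e * (v \<bullet> v) + e\<^sup>2 * (v \<bullet> (M *v v)) \<ge> 0" for e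
      using psd unfolding form[symmetric] pos_semidef_def by blast
    have "v \<noteq> 0"
      using x inv unfolding v_def invertible_left_inverse matrix_left_invertible_ker by blast
    then have a: "v \<bullet> v > 0" by simp
    define d where "d = v \<bullet> (M *v v)"
    have d: "d \<ge> 0" using psd by (simp add: d_def pos_semidef_def)
    \<comment> \<open>any negative step shorter than \<open>2 (v \<bullet> v) / d\<close> would do; \<open>d + 1\<close> avoids the case \<open>d = 0\<close>\<close>
    define e where "e = - (v \<bullet> v) / (d + 1)"
    have e: "e < 0" unfolding e_def using a d by (simp add: divide_less_0_iff)
    have "2 * e * (v \<bullet> v) + e\<^sup>2 * d = e * (2 * (v \<bullet> v) + e * d)"
      by (simp add: power2_eq_square algebra_simps)
    moreover have "2 * (v \<bullet> v) + e * d > 0"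
    proof -
      have "(v \<bullet> v) * (d / (d + 1)) \<le> (v \<bullet> v) * 1"
        using a d by (intro mult_left_mono) auto
      then have "e * d \<ge> - (v \<bullet> v)" unfolding e_def by simp
      then show ?thesis using a by linarith
    qed
    ultimately have "2 * e * (v \<bullet> v) + e\<^sup>2 * d < 0"
      using e by (simp add: mult_neg_pos)
    then show False using ge[of e] unfolding d_def by simp
  qed
qed

text \<open>
  The form of \<open>M + t B\<close> at \<open>x\<close> is affine in \<open>t\<close>, so a negative slope would make it negative for
  large \<open>t\<close>.
\<close>

lemma nonneg_form_direction:
  fixes M B :: "real^'k::finite^'k"
  assumes "\<And>t. t \<ge> 0 \<Longrightarrow> x \<bullet> ((M + t *\<^sub>R B) *v x) \<ge> 0"
  shows "x \<bullet> (B *v x) \<ge> 0"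
proof (rule ccontr)
  define m b where "m = x \<bullet> (M *v x)" and "b = x \<bullet> (B *v x)"
  assume "\<not> x \<bullet> (B *v x) \<ge> 0"
  then have b: "b < 0" by (simp add: b_def)
  have line: "m + t * b \<ge> 0" if "t \<ge> 0" for t
    using assms[OF that] by (simp add: quadratic_form_line m_def b_def)
  have "m \<ge> 0" using line[of 0] by simp
  then have "(m + 1) / (- b) \<ge> 0" using b by (intro divide_nonneg_nonneg) auto
  from line[OF this] show False using b by simp
qed

text \<open>
  On the unit sphere the form of \<open>M\<close> has a positive minimum by compactness, and a small multiple
  of \<open>B\<close> changes it by less.
\<close>

lemma pos_def_open_on_line:
  fixes M B :: "real^'k::finite^'k"
  assumes M: "pos_def M" and B: "transpose B = B"
  obtains \<epsilon> where "\<epsilon> > 0" "\<And>d. \<bar>d\<bar> < \<epsilon> \<Longrightarrow> pos_def (M + d *\<^sub>R B)"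
proof -
  let ?S = "sphere (0 :: real^'k) 1"
  have cont: "continuous_on ?S (\<lambda>x. x \<bullet> (X *v x))" for X :: "real^'k^'k"
    by (intro continuous_intros)
  have "?S \<noteq> {}" by simp
  then obtain x0 where x0: "x0 \<in> ?S" "\<And>x. x \<in> ?S \<Longrightarrow> x0 \<bullet> (M *v x0) \<le> x \<bullet> (M *v x)"
    using continuous_attains_inf[OF compact_sphere _ cont[of M]] by blast
  define m where "m = x0 \<bullet> (M *v x0)"
  have m: "m > 0"
    using x0(1) M unfolding m_def pos_def_def by (metis norm_zero mem_sphere_0 zero_neq_one)
  have "bounded ((\<lambda>x. x \<bullet> (B *v x)) ` ?S)"
    by (intro compact_imp_bounded compact_continuous_image cont compact_sphere)
  then obtain L where L: "L > 0" "\<And>x. x \<in> ?S \<Longrightarrow> \<bar>x \<bullet> (B *v x)\<bar> \<le> L"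
    unfolding bounded_pos by auto
  show ?thesis
  proof
    show "m / L > 0" using m L by simp
    fix d assume d: "\<bar>d\<bar> < m / L"
    show "pos_def (M + d *\<^sub>R B)"
      unfolding pos_def_def
    proof (intro conjI allI impI)
      show "transpose (M + d *\<^sub>R B) = M + d *\<^sub>R B"
        using M B by (intro transpose_add_scaleR_symmetric) (auto simp: pos_def_def)
      fix x :: "real^'k" assume x: "x \<noteq> 0"
      define z where "z = (1 / norm x) *\<^sub>R x"
      have z: "z \<in> ?S" and xz: "x = norm x *\<^sub>R z" using x by (auto simp: z_def)
      have "\<bar>d * (z \<bullet> (B *v z))\<bar> \<le> \<bar>d\<bar> * L"
        unfolding abs_mult by (intro mult_left_mono L z) auto
      also have "\<dots> < m" using d L by (simp add: pos_less_divide_eq)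
      finally have "z \<bullet> ((M + d *\<^sub>R B) *v z) > 0"
        unfolding quadratic_form_line using x0(2)[OF z] unfolding m_def by linarith
      then have "(norm x)\<^sup>2 * (z \<bullet> ((M + d *\<^sub>R B) *v z)) > 0" using x by simp
      also have "(norm x)\<^sup>2 * (z \<bullet> ((M + d *\<^sub>R B) *v z)) = x \<bullet> ((M + d *\<^sub>R B) *v x)"
        by (subst (2 3) xz) (simp only: matrix_vector_mult_scaleR inner_scaleR_left
            inner_scaleR_right power2_eq_square mult.assoc)
      finally show "x \<bullet> ((M + d *\<^sub>R B) *v x) > 0" .
    qed
  qed
qed

lemma eventually_pos_def_line:
  fixes M B :: "real^'k::finite^'k"
  assumes "pos_def (M + t *\<^sub>R B)" and "transpose B = B"
  shows "\<forall>\<^sub>F s in nhds t. pos_def (M + s *\<^sub>R B)"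
proof -
  obtain \<epsilon> where \<epsilon>: "\<epsilon> > 0" "\<And>d. \<bar>d\<bar> < \<epsilon> \<Longrightarrow> pos_def (M + t *\<^sub>R B + d *\<^sub>R B)"
    using pos_def_open_on_line[OF assms] by blast
  have "pos_def (M + s *\<^sub>R B)" if "dist s t < \<epsilon>" for s
    using \<epsilon>(2)[of "s - t"] that by (simp add: dist_real_def scaleR_diff_left)
  with \<epsilon>(1) show ?thesis
    unfolding eventually_nhds_metric by blast
qed

section \<open>The log-determinant barrier along a ray\<close>

lemma log_det_line_derivative:
  fixes M B :: "real^'k::finite^'k"
  assumes pd: "pos_def (M + t *\<^sub>R B)"
  shows "((\<lambda>t. c * t + \<sigma> * ln (det (M + t *\<^sub>R B))) has_real_derivative
           c + \<sigma> * (B \<bullet> matrix_inv (M + t *\<^sub>R B))) (at t)"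
proof -
  have "(\<Sum>k\<in>UNIV. det (row_replace (M + t *\<^sub>R B) B k)) / det (M + t *\<^sub>R B)
      = B \<bullet> matrix_inv (M + t *\<^sub>R B)"
    using sum_det_row_replace[of "M + t *\<^sub>R B" B] pos_def_imp_invertible[OF pd]
      pos_def_imp_det_pos[OF pd] pd by (simp add: pos_def_def)
  moreover have "((\<lambda>t. c * t + \<sigma> * ln (det (M + t *\<^sub>R B))) has_real_derivative
           c + \<sigma> * ((\<Sum>k\<in>UNIV. det (row_replace (M + t *\<^sub>R B) B k)) / det (M + t *\<^sub>R B))) (at t)"
    using pos_def_imp_det_pos[OF pd]
    by (auto intro!: derivative_eq_intros det_line_has_derivative_rows)
  ultimately show ?thesis by simp
qed

text \<open>
  Near a positive definite matrix the expression is a quotient of two polynomials, by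
  \<open>sum_det_row_replace\<close>.
\<close>

lemma isCont_inner_matrix_inv_line:
  fixes M B :: "real^'k::finite^'k"
  assumes pd: "pos_def (M + t *\<^sub>R B)" and B: "transpose B = B"
  shows "isCont (\<lambda>t. B \<bullet> matrix_inv (M + t *\<^sub>R B)) t"
proof -
  let ?q = "\<lambda>t. (\<Sum>k\<in>UNIV. det (row_replace (M + t *\<^sub>R B) B k)) / det (M + t *\<^sub>R B)"
  have "\<forall>\<^sub>F s in nhds t. B \<bullet> matrix_inv (M + s *\<^sub>R B) = ?q s"
    using eventually_pos_def_line[OF assms]
  proof eventually_elim
    case (elim s)
    then show ?case
      using sum_det_row_replace[of "M + s *\<^sub>R B" B] pos_def_imp_invertible[OF elim]
        pos_def_imp_det_pos[OF elim] elim by (simp add: pos_def_def)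
  qed
  moreover have "continuous_on UNIV (\<lambda>t. det (row_replace (M + t *\<^sub>R B) B k))" for k
  proof (rule continuous_on_det)
    show "continuous_on UNIV (\<lambda>t. row_replace (M + t *\<^sub>R B) B k $ p $ q)" for p q
      by (cases "p = k") (auto simp: row_replace_def intro!: continuous_intros)
  qed
  then have "isCont ?q t"
    using pos_def_imp_det_pos[OF pd] DERIV_isCont[OF det_line_has_derivative_rows[of M B t]]
    by (intro continuous_intros) (auto simp: continuous_on_eq_continuous_at)
  ultimately show ?thesis
    using isCont_cong[of "\<lambda>t. B \<bullet> matrix_inv (M + t *\<^sub>R B)" ?q t] by blast
qed

text \<open>
  Follow the ray from a point of positive definiteness at which the barrier increases. As long as
  the derivative stays positive, the barrier stays above its initial value, which keeps the
  determinant away from \<open>0\<close>: the boundary of the positive definite cone cannot be reached first.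
  So the first thing that can go wrong, if anything does, is that the derivative vanishes.
\<close>

lemma log_det_ray_dichotomy:
  fixes M B :: "real^'k::finite^'k" and c \<sigma> :: real
  defines "G \<equiv> \<lambda>t. c + \<sigma> * (B \<bullet> matrix_inv (M + t *\<^sub>R B))"
  assumes M: "pos_def M" and B: "transpose B = B" and \<sigma>: "\<sigma> > 0" and G0: "G 0 > 0"
  obtains (unbounded) "\<And>t. t \<ge> 0 \<Longrightarrow> pos_def (M + t *\<^sub>R B) \<and> G t > 0"
  | (root) r where "r > 0" "G r = 0" "pos_def (M + r *\<^sub>R B)"
      "\<And>t. \<lbrakk>0 \<le> t; t < r\<rbrakk> \<Longrightarrow> pos_def (M + t *\<^sub>R B) \<and> G t > 0"
proof -
  define P where "P = {t. pos_def (M + t *\<^sub>R B) \<and> G t > 0}"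
  have contG: "isCont G t" if "pos_def (M + t *\<^sub>R B)" for t
    unfolding G_def by (intro continuous_intros isCont_inner_matrix_inv_line that B)
  have "open P"
  proof (subst open_subopen, rule ballI)
    fix t assume t: "t \<in> P"
    have pd: "pos_def (M + t *\<^sub>R B)" and "G t > 0"
      using t unfolding P_def by auto
    have "(G \<longlongrightarrow> G t) (nhds t)"
      using contG[OF pd] tendsto_at_iff_tendsto_nhds[of G t] unfolding isCont_def by blast
    then have "\<forall>\<^sub>F s in nhds t. G s > 0"
      using \<open>G t > 0\<close> by (rule order_tendstoD(1))
    moreover have "\<forall>\<^sub>F s in nhds t. pos_def (M + s *\<^sub>R B)"
      using pd B by (rule eventually_pos_def_line)
    ultimately have "\<forall>\<^sub>F s in nhds t. s \<in> P"
      unfolding P_def by eventually_elim simp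
    then show "\<exists>U. open U \<and> t \<in> U \<and> U \<subseteq> P"
      unfolding eventually_nhds by blast
  qed
  show thesis
  proof (cases "{0..} \<subseteq> P")
    case True
    then show thesis using unbounded unfolding P_def by auto
  next
    case False
    define r where "r = Inf ({0..} - P)"
    have bdd: "bdd_below ({0..} - P)" by (rule bdd_below_mono[of "{0..}"]) auto
    have "r \<in> {0..} - P"
      unfolding r_def using False \<open>open P\<close> bdd
      by (intro closed_contains_Inf closed_Diff) auto
    then have r: "r \<ge> 0" "r \<notin> P" by auto
    have below: "t \<in> P" if "0 \<le> t" "t < r" for t
    proof (rule ccontr)
      assume "t \<notin> P"
      with that(1) have "r \<le> t" unfolding r_def by (intro cInf_lower bdd) auto
      with that(2) show False by simp
    qed
    have "0 \<in> P" using M G0 by (simp add: P_def)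
    with r have r0: "r > 0" by (metis order_le_less)
    then have rcl: "closure {0..<r} = {0..r}" by simp

    have "pos_semidef (M + r *\<^sub>R B)"
      unfolding pos_semidef_def
    proof (intro conjI allI)
      show "transpose (M + r *\<^sub>R B) = M + r *\<^sub>R B"
        using M B by (intro transpose_add_scaleR_symmetric) (auto simp: pos_def_def)
      fix x :: "real^'k"
      show "0 \<le> x \<bullet> ((M + r *\<^sub>R B) *v x)"
      proof (rule continuous_ge_on_closure[of "{0..<r}" "\<lambda>s. x \<bullet> ((M + s *\<^sub>R B) *v x)"])
        show "continuous_on (closure {0..<r}) (\<lambda>s. x \<bullet> ((M + s *\<^sub>R B) *v x))"
          unfolding quadratic_form_line by (intro continuous_intros)
        show "r \<in> closure {0..<r}" using r0 unfolding rcl by simp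
        fix s assume "s \<in> {0..<r}"
        then have "pos_def (M + s *\<^sub>R B)" using below by (auto simp: P_def)
        then show "0 \<le> x \<bullet> ((M + s *\<^sub>R B) *v x)"
          using pos_def_imp_pos_semidef unfolding pos_semidef_def by blast
      qed
    qed
    moreover have "det (M + r *\<^sub>R B) > 0"
    proof -
      \<comment> \<open>exponentiating the lower bound on the barrier gives a bound that survives the limit \<open>s \<rightarrow> r\<close>\<close>
      let ?low = "\<lambda>s. exp (ln (det M) - c * s / \<sigma>)"
      have "det (M + s *\<^sub>R B) - ?low s \<ge> 0" if s: "s \<in> {0..<r}" for s
      proof -
        have "c * 0 + \<sigma> * ln (det (M + 0 *\<^sub>R B)) \<le> c * s + \<sigma> * ln (det (M + s *\<^sub>R B))"
        proof (rule DERIV_nonneg_imp_nondecreasing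
            [where f = "\<lambda>t. c * t + \<sigma> * ln (det (M + t *\<^sub>R B))"])
          show "0 \<le> s" using s by simp
          fix x assume "0 \<le> x" "x \<le> s"
          then have "x \<in> P" using s by (intro below) auto
          then show "\<exists>d. ((\<lambda>t. c * t + \<sigma> * ln (det (M + t *\<^sub>R B))) has_real_derivative d) (at x)
              \<and> 0 \<le> d"
            using log_det_line_derivative[of M x B c \<sigma>] unfolding P_def G_def
            by (auto intro: less_imp_le)
        qed
        then have "ln (det M) - c * s / \<sigma> \<le> ln (det (M + s *\<^sub>R B))"
          using \<sigma> by (simp add: field_simps)
        moreover have "det (M + s *\<^sub>R B) > 0"
          using below[of s] s by (auto simp: P_def intro: pos_def_imp_det_pos)
        ultimately show ?thesis by (simp add: ln_ge_iff)
      qed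
      then have "det (M + r *\<^sub>R B) - ?low r \<ge> 0"
      proof (rule continuous_ge_on_closure[of "{0..<r}" "\<lambda>s. det (M + s *\<^sub>R B) - ?low s", rotated 2])
        show "continuous_on (closure {0..<r}) (\<lambda>s. det (M + s *\<^sub>R B) - ?low s)"
          using \<sigma> by (intro continuous_intros continuous_on_det)
            (auto intro!: continuous_intros)
        show "r \<in> closure {0..<r}" using r0 unfolding rcl by simp
      qed
      then show ?thesis using exp_gt_zero[of "ln (det M) - c * r / \<sigma>"] by linarith
    qed
    ultimately have pdr: "pos_def (M + r *\<^sub>R B)"
      by (intro pos_semidef_invertible_imp_pos_def) (auto simp: invertible_det_nz)

    have "G r \<ge> 0"
    proof (rule tendsto_lowerbound)
      show "(G \<longlongrightarrow> G r) (at_left r)"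
        using contG[OF pdr] unfolding isCont_def by (rule tendsto_within_subset) simp
      show "\<forall>\<^sub>F s in at_left r. 0 \<le> G s"
        using eventually_at_left_real[OF r0]
      proof eventually_elim
        case (elim s)
        then have "s \<in> P" by (intro below) auto
        then show ?case by (simp add: P_def)
      qed
    qed simp
    with r(2) pdr have "G r = 0" by (auto simp: P_def)
    then show thesis
      using root r0 pdr below unfolding P_def by blast
  qed
qed

text \<open>
  If the derivative were positive throughout, the barrier would stay above its initial value. But
  for \<open>c < 0\<close> the logarithm of the polynomially bounded determinant cannot compensate for \<open>c t\<close>.
\<close>

lemma log_det_ray_not_increasing:
  fixes M B :: "real^'k::finite^'k" and c \<sigma> :: real
  assumes \<sigma>: "\<sigma> > 0" and c: "c < 0" and pd: "\<And>t. t \<ge> 0 \<Longrightarrow> pos_def (M + t *\<^sub>R B)"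
  shows "\<exists>t\<ge>0. c + \<sigma> * (B \<bullet> matrix_inv (M + t *\<^sub>R B)) \<le> 0"
proof (rule ccontr)
  assume "\<not> ?thesis"
  then have pos: "c + \<sigma> * (B \<bullet> matrix_inv (M + t *\<^sub>R B)) > 0" if "t \<ge> 0" for t
    using that by (meson not_le)
  obtain K where K: "K > 0" "\<And>t. t \<ge> 0 \<Longrightarrow> det (M + t *\<^sub>R B) \<le> K * (1 + t) ^ CARD('k)"
    using det_line_polynomial_bound by blast
  define a where "a = \<sigma> * ln (det M) - \<sigma> * ln K"
  define N where "N = \<sigma> * real CARD('k)"
  have "a \<le> c * t + N * ln (1 + t)" if t: "t \<ge> 0" for t
  proof -
    have "c * 0 + \<sigma> * ln (det (M + 0 *\<^sub>R B)) \<le> c * t + \<sigma> * ln (det (M + t *\<^sub>R B))"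
    proof (rule DERIV_nonneg_imp_nondecreasing
          [where f = "\<lambda>t. c * t + \<sigma> * ln (det (M + t *\<^sub>R B))"])
      fix x :: real assume "0 \<le> x"
      then show "\<exists>d. ((\<lambda>t. c * t + \<sigma> * ln (det (M + t *\<^sub>R B))) has_real_derivative d) (at x)
          \<and> 0 \<le> d"
        using log_det_line_derivative[OF pd, of x c \<sigma>] pos[of x] by (auto intro: less_imp_le)
    qed (use t in simp)
    moreover have "ln (det (M + t *\<^sub>R B)) \<le> ln (K * (1 + t) ^ CARD('k))"
      using K t pos_def_imp_det_pos[OF pd[OF t]] by (subst ln_le_cancel_iff) auto
    moreover have "ln (K * (1 + t) ^ CARD('k)) = ln K + real CARD('k) * ln (1 + t)"
      using K t by (simp add: ln_mult ln_realpow)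
    ultimately have "\<sigma> * ln (det M) \<le> c * t + \<sigma> * (ln K + real CARD('k) * ln (1 + t))"
      using \<sigma> by (smt (verit) mult_left_mono mult_zero_right add_0 scaleR_zero_left add.right_neutral)
    then show ?thesis by (simp add: a_def N_def algebra_simps)
  qed
  moreover have "filterlim (\<lambda>t. c * t + N * ln (1 + t)) at_bot at_top"
    using c by real_asymp
  then have "\<forall>\<^sub>F t in at_top. c * t + N * ln (1 + t) < a \<and> t \<ge> 0"
    by (intro eventually_conj eventually_ge_at_top) (simp add: filterlim_at_bot_dense)
  then obtain t where "c * t + N * ln (1 + t) < a" "t \<ge> 0"
    using eventually_happens trivial_limit_at_top_linorder by blast
  ultimately show False by fastforce
qed

section \<open>The coordinate matrices and the slack along a coordinate line\<close>

lemma transpose_arrow_mat: "transpose (arrow_mat i a b c) = arrow_mat i a b c"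
  by (auto simp: arrow_mat_def transpose_def vec_eq_iff)

lemma transpose_A_mat: "transpose (A_mat l u \<beta> i j) = A_mat l u \<beta> i j"
  by (simp add: A_mat_def transpose_arrow_mat)

lemma quadratic_form_arrow_mat:
  fixes i :: "'n::finite"
  shows "(axis None p + axis (Some i) q) \<bullet> (arrow_mat i a b c *v (axis None p + axis (Some i) q))
    = a * p\<^sup>2 + 2 * b * p * q + c * q\<^sup>2"
proof -
  have entry: "(arrow_mat i a b c *v (axis None p + axis (Some i) q)) $ r
      = arrow_mat i a b c $ r $ None * p + arrow_mat i a b c $ r $ Some i * q" for r
  proof -
    have "(X *v axis k z) $ r = X $ r $ k * z" for X :: "real^'n option^'n option" and k z
      by (simp add: matrix_vector_mult_def axis_def if_distrib cong: if_cong)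
    then show ?thesis by (simp add: matrix_vector_right_distrib)
  qed
  show ?thesis
    by (simp add: inner_add_left inner_axis' entry)
       (simp add: arrow_mat_def power2_eq_square algebra_simps)
qed

text \<open>
  For \<open>j < u\<^sub>i\<close> the diagonal entry \<open>-1\<close> excludes semidefiniteness. For \<open>j = u\<^sub>i\<close> the form at
  \<open>(1, x)\<close> is \<open>\<beta>\<^sub>i\<^sub>j + (x - l\<^sub>i) (x - u\<^sub>i)\<close>, which is smallest at the midpoint of \<open>l\<^sub>i\<close> and \<open>u\<^sub>i\<close>; there
  the product is negative because \<open>l\<^sub>i < u\<^sub>i\<close>.
\<close>

lemma A_mat_nonneg_imp_beta_pos:
  assumes lu: "l i < u i"
    and nonneg: "\<And>x. x \<bullet> (A_mat l u \<beta> i j *v x) \<ge> 0"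
  shows "\<beta> i j > 0"
proof (cases "j = u i")
  case False
  then show ?thesis
    using nonneg[of "axis None 0 + axis (Some i) 1"]
    unfolding A_mat_def by (simp add: quadratic_form_arrow_mat del: axis_eq_0_iff)
next
  case True
  define a b where "a = real_of_int (l i)" and "b = real_of_int (u i)"
  have "a < b" using lu by (simp add: a_def b_def)
  have "0 \<le> \<beta> i j + a * b - (a + b) * ((a + b) / 2) + ((a + b) / 2)\<^sup>2"
    using nonneg[of "axis None 1 + axis (Some i) ((a + b) / 2)"] True
    unfolding A_mat_def if_P[OF True] quadratic_form_arrow_mat of_int_mult of_int_add
      a_def[symmetric] b_def[symmetric]
    by (simp add: field_simps)
  also have "\<dots> = \<beta> i j - (b - a)\<^sup>2 / 4"
    by (simp add: power2_eq_square field_simps)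
  finally have "\<beta> i j \<ge> (b - a)\<^sup>2 / 4" by simp
  moreover have "(b - a)\<^sup>2 > 0" using \<open>a < b\<close> by simp
  ultimately show ?thesis by linarith
qed

lemma finite_pairs: "finite (pairs l u)"
  by (simp add: pairs_def)

lemma slack_shift:
  assumes "(i, j) \<in> pairs l u"
  shows "slack Q l u \<beta> (shift y s i j) = slack Q l u \<beta> y - s *\<^sub>R A_mat l u \<beta> i j"
proof -
  have "(\<Sum>p\<in>pairs l u. (s * (if p = (i, j) then 1 else 0)) *\<^sub>R A_mat l u \<beta> (fst p) (snd p))
      = (\<Sum>p\<in>pairs l u. if p = (i, j) then s *\<^sub>R A_mat l u \<beta> i j else 0)"
    by (intro sum.cong) auto
  also have "\<dots> = s *\<^sub>R A_mat l u \<beta> i j"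
    using assms by (simp add: finite_pairs)
  finally show ?thesis
    by (simp add: slack_def adjoint_map_def shift_def case_prod_unfold prod_eq_iff
        scaleR_add_left sum.distrib)
qed

lemma dvec_inner_shift:
  assumes "(i, j) \<in> pairs l u"
  shows "dvec_inner l u (b_vec \<beta>) (shift y s i j) = dvec_inner l u (b_vec \<beta>) y + \<beta> i j * s"
proof -
  let ?I = "insert None (Some ` pairs l u)"
  have "(\<Sum>p\<in>?I. b_vec \<beta> p * (s * (if p = Some (i, j) then 1 else 0)))
      = (\<Sum>p\<in>?I. if p = Some (i, j) then \<beta> i j * s else 0)"
    by (intro sum.cong) (auto simp: b_vec_def)
  also have "\<dots> = \<beta> i j * s"
    using assms by (subst sum.delta) (auto simp: finite_pairs)
  finally show ?thesis
    by (simp add: dvec_inner_def shift_def distrib_left sum.distrib)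
qed

section \<open>Line search along one coordinate\<close>

theorem theorem9:
  fixes Qh :: "real^'n::finite^'n" and lh :: "real^'n" and ch :: real
    and l u :: "'n \<Rightarrow> int" and \<beta> :: "'n \<Rightarrow> int \<Rightarrow> real"
    and \<sigma> :: real and y :: "'n dvec" and i :: 'n and j :: int
    and Q W :: "real^('n option)^('n option)"
  assumes Qh_sym: "transpose Qh = Qh"
    and l_less_u: "\<And>k. l k < u k"
    and Q: "Q = Q_mat Qh lh ch"
    and sigma_pos: "\<sigma> > 0"
    and slack_pd: "pos_def (slack Q l u \<beta> y)"
    and y_nonpos: "\<And>k h. (k, h) \<in> pairs l u \<Longrightarrow> y (Some (k, h)) \<le> 0"
    and W: "W = matrix_inv (slack Q l u \<beta> y)"
    and ij: "(i, j) \<in> pairs l u"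
  shows
    \<comment> \<open>the two expressions are the derivatives of the barrier function\<close>
    "(\<forall>s. pos_def (slack Q l u \<beta> (shift y s i j)) \<longrightarrow>
        s \<in> line_dom l u \<beta> W i j \<and>
        ((\<lambda>t. barrier Q l u \<beta> \<sigma> (shift y t i j)) has_real_derivative
           line_grad l u \<beta> \<sigma> W i j s) (at s)) \<and>
     ((\<lambda>t. barrier Q l u \<beta> \<sigma> (shift y t i j)) has_real_derivative
        coord_grad l u \<beta> \<sigma> W i j) (at 0) \<and>
     (coord_grad l u \<beta> \<sigma> W i j > 0 \<and> y (Some (i, j)) < 0 \<longrightarrow>
        (if \<exists>s>0. line_root l u \<beta> \<sigma> W i j s
         then \<exists>sp>0. line_root l u \<beta> \<sigma> W i j sp \<and>
                (\<forall>s>0. line_root l u \<beta> \<sigma> W i j s \<longrightarrow> sp \<le> s) \<and>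
                ((dual_feasible Q l u \<beta> (shift y sp i j) \<and> line_grad l u \<beta> \<sigma> W i j sp = 0) \<or>
                 (y (Some (i, j)) + sp > 0 \<and>
                  - y (Some (i, j)) \<in> line_dom l u \<beta> W i j \<and>
                  line_grad l u \<beta> \<sigma> W i j (- y (Some (i, j))) > 0))
         else - y (Some (i, j)) \<in> line_dom l u \<beta> W i j \<and>
              line_grad l u \<beta> \<sigma> W i j (- y (Some (i, j))) > 0)) \<and>
     (coord_grad l u \<beta> \<sigma> W i j < 0 \<longrightarrow>
        (\<exists>sm<0. line_root l u \<beta> \<sigma> W i j sm \<and>
           (\<forall>s<0. line_root l u \<beta> \<sigma> W i j s \<longrightarrow> s \<le> sm) \<and>
           dual_feasible Q l u \<beta> (shift y sm i j) \<and> line_grad l u \<beta> \<sigma> W i j sm = 0))"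
proof -
  define S where "S = slack Q l u \<beta> y"
  define A where "A = A_mat l u \<beta> i j"
  have S: "pos_def S" using slack_pd by (simp add: S_def)
  have A: "transpose A = A" by (simp add: A_def transpose_A_mat)
  have negA: "transpose (- A) = - A"
    using A transpose_scalar[of "-1" A] by simp
  have WS: "matrix_inv W = S"
    unfolding W S_def[symmetric] by (intro matrix_inv_matrix_inv pos_def_imp_invertible S)
  have slack_line: "slack Q l u \<beta> (shift y s i j) = S + s *\<^sub>R (- A)" for s
    using ij by (simp add: slack_shift S_def A_def)
  have dom: "s \<in> line_dom l u \<beta> W i j" if "pos_def (S + s *\<^sub>R (- A))" for s
    using pos_def_imp_invertible[OF that] by (simp add: line_dom_def WS A_def)
  have grad: "line_grad l u \<beta> \<sigma> W i j s
      = \<beta> i j + \<sigma> * ((- A) \<bullet> matrix_inv (S + s *\<^sub>R (- A)))" for s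
    by (simp add: line_grad_def WS A_def)
  have coord: "coord_grad l u \<beta> \<sigma> W i j = line_grad l u \<beta> \<sigma> W i j 0"
    unfolding grad by (simp add: coord_grad_def A_def W S_def)
  have feasible: "dual_feasible Q l u \<beta> (shift y s i j)"
    if "pos_def (S + s *\<^sub>R (- A))" "y (Some (i, j)) + s \<le> 0" for s
    using that y_nonpos pos_def_imp_pos_semidef
    unfolding dual_feasible_def slack_line by (auto simp: shift_def)

  have deriv: "((\<lambda>t. barrier Q l u \<beta> \<sigma> (shift y t i j)) has_real_derivative
      line_grad l u \<beta> \<sigma> W i j s) (at s)" if "pos_def (S + s *\<^sub>R (- A))" for s
  proof -
    have "((\<lambda>t. dvec_inner l u (b_vec \<beta>) y + (\<beta> i j * t + \<sigma> * ln (det (S + t *\<^sub>R (- A)))))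
        has_real_derivative 0 + line_grad l u \<beta> \<sigma> W i j s) (at s)"
      unfolding grad by (intro DERIV_add DERIV_const log_det_line_derivative that)
    then show ?thesis
      by (simp only: barrier_def slack_line dvec_inner_shift[OF ij] add.assoc add_0)
  qed
  have deriv0: "((\<lambda>t. barrier Q l u \<beta> \<sigma> (shift y t i j)) has_real_derivative
      coord_grad l u \<beta> \<sigma> W i j) (at 0)"
    unfolding coord using S by (intro deriv) simp

  have part_i: "if \<exists>s>0. line_root l u \<beta> \<sigma> W i j s
         then \<exists>sp>0. line_root l u \<beta> \<sigma> W i j sp \<and>
                (\<forall>s>0. line_root l u \<beta> \<sigma> W i j s \<longrightarrow> sp \<le> s) \<and>
                ((dual_feasible Q l u \<beta> (shift y sp i j) \<and> line_grad l u \<beta> \<sigma> W i j sp = 0) \<or>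
                 (y (Some (i, j)) + sp > 0 \<and>
                  - y (Some (i, j)) \<in> line_dom l u \<beta> W i j \<and>
                  line_grad l u \<beta> \<sigma> W i j (- y (Some (i, j))) > 0))
         else - y (Some (i, j)) \<in> line_dom l u \<beta> W i j \<and>
              line_grad l u \<beta> \<sigma> W i j (- y (Some (i, j))) > 0"
    (is ?part_i)
    if pos: "coord_grad l u \<beta> \<sigma> W i j > 0" and neg: "y (Some (i, j)) < 0"
  proof -
    have start: "\<beta> i j + \<sigma> * ((- A) \<bullet> matrix_inv (S + 0 *\<^sub>R (- A))) > 0"
      using pos unfolding coord grad .
    show ?part_i
    proof (rule log_det_ray_dichotomy[OF S negA sigma_pos start])
      assume all: "pos_def (S + t *\<^sub>R (- A)) \<and>
        \<beta> i j + \<sigma> * ((- A) \<bullet> matrix_inv (S + t *\<^sub>R (- A))) > 0" if "t \<ge> 0" for t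
      have no_root: "\<not> line_root l u \<beta> \<sigma> W i j s" if "s > 0" for s
        using all[of s] that unfolding line_root_def grad by auto
      show ?part_i
        using no_root dom[of "- y (Some (i, j))"] all[of "- y (Some (i, j))"] neg
        unfolding grad by auto
    next
      fix r
      assume r: "r > 0" "\<beta> i j + \<sigma> * ((- A) \<bullet> matrix_inv (S + r *\<^sub>R (- A))) = 0"
          "pos_def (S + r *\<^sub>R (- A))"
        and below: "\<And>t. \<lbrakk>0 \<le> t; t < r\<rbrakk> \<Longrightarrow> pos_def (S + t *\<^sub>R (- A)) \<and>
          \<beta> i j + \<sigma> * ((- A) \<bullet> matrix_inv (S + t *\<^sub>R (- A))) > 0"
      have root: "line_root l u \<beta> \<sigma> W i j r"
        using r dom unfolding line_root_def grad by blast
      have least: "r \<le> s" if "s > 0" "line_root l u \<beta> \<sigma> W i j s" for s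
        using below[of s] that unfolding line_root_def grad by (cases "s < r") auto
      have "(dual_feasible Q l u \<beta> (shift y r i j) \<and> line_grad l u \<beta> \<sigma> W i j r = 0) \<or>
          (y (Some (i, j)) + r > 0 \<and> - y (Some (i, j)) \<in> line_dom l u \<beta> W i j \<and>
           line_grad l u \<beta> \<sigma> W i j (- y (Some (i, j))) > 0)"
      proof (cases "y (Some (i, j)) + r \<le> 0")
        case True
        then show ?thesis using feasible r root unfolding line_root_def by blast
      next
        case False
        then show ?thesis
          using below[of "- y (Some (i, j))"] dom[of "- y (Some (i, j))"] neg
          unfolding grad by auto
      qed
      with r(1) root least show ?part_i by (smt (verit, best))
    qed
  qed

  have part_ii: "\<exists>sm<0. line_root l u \<beta> \<sigma> W i j sm \<and>
           (\<forall>s<0. line_root l u \<beta> \<sigma> W i j s \<longrightarrow> s \<le> sm) \<and>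
           dual_feasible Q l u \<beta> (shift y sm i j) \<and> line_grad l u \<beta> \<sigma> W i j sm = 0"
    (is ?part_ii)
    if neg: "coord_grad l u \<beta> \<sigma> W i j < 0"
  proof -
    \<comment> \<open>substituting \<open>s = -t\<close> turns the search to the left into an ascent along the ray \<open>S + t A\<close>\<close>
    have mirror: "- line_grad l u \<beta> \<sigma> W i j (- t)
        = - \<beta> i j + \<sigma> * (A \<bullet> matrix_inv (S + t *\<^sub>R A))" for t
      unfolding grad by simp
    have start: "- \<beta> i j + \<sigma> * (A \<bullet> matrix_inv (S + 0 *\<^sub>R A)) > 0"
      using neg mirror[of 0] unfolding coord by simp
    show ?part_ii
    proof (rule log_det_ray_dichotomy[OF S A sigma_pos start])
      assume all: "pos_def (S + t *\<^sub>R A) \<and>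
        - \<beta> i j + \<sigma> * (A \<bullet> matrix_inv (S + t *\<^sub>R A)) > 0" if "t \<ge> 0" for t
      \<comment> \<open>an unbounded ray forces \<open>\<beta> i j > 0\<close>, so the barrier cannot increase along all of it\<close>
      have "x \<bullet> (A *v x) \<ge> 0" for x
      proof (rule nonneg_form_direction[of x S])
        show "x \<bullet> ((S + t *\<^sub>R A) *v x) \<ge> 0" if "t \<ge> 0" for t
          using all[OF that] pos_def_imp_pos_semidef unfolding pos_semidef_def by blast
      qed
      then have "\<beta> i j > 0"
        using l_less_u unfolding A_def by (intro A_mat_nonneg_imp_beta_pos)
      then obtain t where "t \<ge> 0" "- \<beta> i j + \<sigma> * (A \<bullet> matrix_inv (S + t *\<^sub>R A)) \<le> 0"
        using log_det_ray_not_increasing[OF sigma_pos, of "- \<beta> i j" S A] all by auto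
      with all[of t] show ?part_ii by simp
    next
      fix r
      assume r: "r > 0" "- \<beta> i j + \<sigma> * (A \<bullet> matrix_inv (S + r *\<^sub>R A)) = 0"
          "pos_def (S + r *\<^sub>R A)"
        and below: "\<And>t. \<lbrakk>0 \<le> t; t < r\<rbrakk> \<Longrightarrow> pos_def (S + t *\<^sub>R A) \<and>
          - \<beta> i j + \<sigma> * (A \<bullet> matrix_inv (S + t *\<^sub>R A)) > 0"
      have pd: "pos_def (S + (- r) *\<^sub>R (- A))" using r(3) by simp
      have zero: "line_grad l u \<beta> \<sigma> W i j (- r) = 0" using mirror[of r] r(2) by simp
      have root: "line_root l u \<beta> \<sigma> W i j (- r)"
        using dom[OF pd] zero unfolding line_root_def by blast
      have largest: "s \<le> - r" if "s < 0" "line_root l u \<beta> \<sigma> W i j s" for s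
        using below[of "- s"] that mirror[of "- s"] unfolding line_root_def
        by (cases "- s < r") auto
      have "y (Some (i, j)) + - r \<le> 0" using y_nonpos[OF ij] r(1) by simp
      then show ?part_ii
        using feasible[OF pd] root largest zero r(1) by (intro exI[of _ "- r"]) auto
    qed
  qed

  show ?thesis
    using deriv deriv0 dom part_i part_ii unfolding slack_line by blast
qed

end
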